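(* Let $X$ be a regular space with $G_\delta$ points such that each point has a closed $[\aleph_0,\aleph_1]$-compact neighborhood. Let $S$ be a stationary subset of $\omega_1$ endowed with the subspace topology. Then there is no continuous $h\colon S\times[0,1]\to X$ such that $h(\cdot,1)\colon S\to X$ has an uncountable image and $h(\cdot,0)$ is constant. In particular, if $X$ contains a copy of $S$ (a subspace homeomorphic to $S$), then $X$ is not contractible.
   Context: All topological spaces are Hausdorff (in particular regular includes Hausdorff). $\omega_1$ carries the order topology. A space has $G_\delta$ points if each singleton is a $G_\delta$ set. A space is $[\aleph_0,\aleph_1]$-compact iff every open cover of size $\le\aleph_1$ has a countable subcover; equivalently, for every uncountable subspace $E$ there is a point $x$ of the space which is a condensation point of $E$, i.e. every neighborhood of $x$ contains uncountably many points of $E$. A space $X$ is contractible if there is a continuous $h\colon X\times[0,1]\to X$ with $h(x,1)=x$ for all $x$ and $h(\cdot,0)$ constant. *)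

theory Defs
  imports "HOL-Analysis.Analysis" "HOL-Library.Countable_Set_Type"
begin

unbundle cardinal_syntax

text \<open>
  The ordinal \<open>\<omega>\<^sub>1\<close> as a type: the well-order \<open>cardSuc natLeq\<close> is the initial
  ordinal of the successor cardinal of \<open>\<aleph>\<^sub>0\<close>. The lemmas \<open>uncountable_omega1\<close> and
  \<open>countable_lessThan_omega1\<close> characterise it up to order isomorphism.
\<close>

typedef omega1 = "Field (cardSuc natLeq)"
proof -
  have "natLeq <o cardSuc natLeq"
    by (simp add: cardSuc_greater natLeq_Card_order)
  then have "infinite (Field (cardSuc natLeq))"
    using cardSuc_finite[OF natLeq_Card_order] Field_natLeq by simp
  then have "Field (cardSuc natLeq) \<noteq> {}"
    by force
  then show ?thesis by blast
qed

lemma Well_order_cardSuc_natLeq: "Well_order (cardSuc natLeq)"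
  using cardSuc_Card_order[OF natLeq_Card_order] card_order_on_well_order_on by blast

instantiation omega1 :: linorder
begin

definition less_eq_omega1 :: "omega1 \<Rightarrow> omega1 \<Rightarrow> bool"
  where "x \<le> y \<longleftrightarrow> (Rep_omega1 x, Rep_omega1 y) \<in> cardSuc natLeq"

definition less_omega1 :: "omega1 \<Rightarrow> omega1 \<Rightarrow> bool"
  where "(x :: omega1) < y \<longleftrightarrow> x \<le> y \<and> x \<noteq> y"

instance
proof
  have L: "Linear_order (cardSuc natLeq)"
    using Well_order_cardSuc_natLeq by (simp add: well_order_on_def)
  then have refl: "refl_on (Field (cardSuc natLeq)) (cardSuc natLeq)"
    and trans: "trans (cardSuc natLeq)" and anti: "antisym (cardSuc natLeq)"
    and tot: "total_on (Field (cardSuc natLeq)) (cardSuc natLeq)"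
    by (auto simp: order_on_defs)
  fix x y z :: omega1
  show antisym: "x \<le> y \<Longrightarrow> y \<le> x \<Longrightarrow> x = y"
    unfolding less_eq_omega1_def using anti Rep_omega1_inject by (blast dest: antisymD)
  then show "x < y \<longleftrightarrow> x \<le> y \<and> \<not> y \<le> x"
    unfolding less_omega1_def by (metis less_eq_omega1_def Rep_omega1 refl refl_onD)
  show "x \<le> x"
    unfolding less_eq_omega1_def using refl Rep_omega1 by (metis refl_onD)
  show "x \<le> y \<Longrightarrow> y \<le> z \<Longrightarrow> x \<le> z"
    unfolding less_eq_omega1_def using trans by (blast dest: transD)
  show "x \<le> y \<or> y \<le> x"
    unfolding less_eq_omega1_def using tot refl Rep_omega1
    by (metis refl_onD total_on_def)
qed

end

instance omega1 :: wellorder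
proof
  fix P :: "omega1 \<Rightarrow> bool" and a
  assume step: "\<And>x. (\<And>y. y < x \<Longrightarrow> P y) \<Longrightarrow> P x"
  have "wf (cardSuc natLeq - Id)"
    using Well_order_cardSuc_natLeq by (simp add: well_order_on_def)
  then have "wf (inv_image (cardSuc natLeq - Id) Rep_omega1)"
    by (rule wf_inv_image)
  then show "P a"
  proof (induction a rule: wf_induct_rule)
    case (less x)
    show ?case
      by (rule step, rule less)
        (auto simp: less_omega1_def less_eq_omega1_def Rep_omega1_inject)
  qed
qed

instantiation omega1 :: linorder_topology
begin

definition open_omega1 :: "omega1 set \<Rightarrow> bool"
  where "open_omega1 = generate_topology (range (\<lambda>a. {..<a}) \<union> range (\<lambda>a. {a<..}))"

instance
  by standard (rule open_omega1_def)

end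

lemma uncountable_omega1: "uncountable (UNIV :: omega1 set)"
proof
  assume "countable (UNIV :: omega1 set)"
  then have "countable (Field (cardSuc natLeq))"
    by (metis countable_image type_definition.Rep_range type_definition_omega1)
  then have "|Field (cardSuc natLeq)| \<le>o natLeq"
    by (simp add: countable_card_le_natLeq)
  then have "cardSuc natLeq \<le>o natLeq"
    using card_of_Field_ordIso[OF cardSuc_Card_order[OF natLeq_Card_order]]
      ordIso_ordLeq_trans ordIso_symmetric by blast
  then show False
    using cardSuc_greater[OF natLeq_Card_order] not_ordLess_ordLeq by blast
qed

lemma countable_lessThan_omega1: "countable {..<a :: omega1}"
proof -
  have "|underS (cardSuc natLeq) (Rep_omega1 a)| <o cardSuc natLeq"
    by (rule card_of_underS[OF cardSuc_Card_order[OF natLeq_Card_order] Rep_omega1])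
  then have "countable (underS (cardSuc natLeq) (Rep_omega1 a))"
    unfolding countable_card_le_natLeq
    by (rule iffD1[OF cardSuc_ordLeq_ordLess[OF natLeq_Card_order card_of_Card_order]])
  moreover have "Rep_omega1 ` {..<a} \<subseteq> underS (cardSuc natLeq) (Rep_omega1 a)"
    by (auto simp: underS_def less_omega1_def less_eq_omega1_def Rep_omega1_inject)
  ultimately have "countable (Rep_omega1 ` {..<a})"
    using countable_subset by blast
  then show ?thesis
    by (rule countable_image_inj_on) (simp add: inj_on_def Rep_omega1_inject)
qed

definition club :: "omega1 set \<Rightarrow> bool"
  where "club C \<longleftrightarrow> closed C \<and> (\<forall>a. \<exists>c\<in>C. a < c)"

definition stationary :: "omega1 set \<Rightarrow> bool"
  where "stationary S \<longleftrightarrow> (\<forall>C. club C \<longrightarrow> S \<inter> C \<noteq> {})"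

text \<open>
  \<open>[\<aleph>\<^sub>0, \<aleph>\<^sub>1]\<close>-compactness; \<open>\<U> \<lesssim> (UNIV :: omega1 set)\<close> says that \<open>\<U>\<close> has cardinality
  at most \<open>\<aleph>\<^sub>1\<close>.
\<close>

definition aleph0_aleph1_compact_space :: "'a topology \<Rightarrow> bool"
  where "aleph0_aleph1_compact_space X \<longleftrightarrow>
    (\<forall>\<U>. (\<forall>U\<in>\<U>. openin X U) \<and> \<Union>\<U> = topspace X \<and> \<U> \<lesssim> (UNIV :: omega1 set) \<longrightarrow>
      (\<exists>\<V>. \<V> \<subseteq> \<U> \<and> countable \<V> \<and> \<Union>\<V> = topspace X))"

end

theory Submission
  imports Defs
begin

text \<open>
  Call a map on \<open>S\<close> eventually constant if it is constant on a tail of \<open>S\<close>. Since \<open>S\<close> meets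
  every club, disjoint relatively closed subsets of \<open>S\<close> cannot both be unbounded. Hence, if the
  preimage under \<open>f\<close> of every neighbourhood of a point \<open>x\<close> is unbounded, then by regularity each
  such preimage contains a tail of \<open>S\<close>, and as \<open>x\<close> is a \<open>G\<^sub>\<delta>\<close> point, \<open>f\<close> is eventually
  equal to \<open>x\<close>. The set of \<open>t\<close> for which \<open>h(\<cdot>, t)\<close> is eventually constant contains \<open>0\<close>; it is
  closed since countably many tails share a tail, and open since for \<open>t'\<close> near \<open>t\<close> uncountably
  many \<open>s\<close> are mapped by \<open>h(\<cdot>, t')\<close> into one \<open>[\<aleph>\<^sub>0, \<aleph>\<^sub>1]\<close>-compact neighbourhood,
  where they accumulate. So \<open>h(\<cdot>, 1)\<close> is eventually constant and has a countable image.
\<close>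

section \<open>Countable, bounded and uncountable subsets of \<omega>1\<close>

lemma countable_atMost_omega1: "countable {..a :: omega1}"
proof -
  have "{..a} = insert a {..<a}" by auto
  then show ?thesis by (simp add: countable_lessThan_omega1)
qed

lemma uncountable_imp_unbounded_omega1:
  assumes "uncountable (A :: omega1 set)"
  shows "\<exists>x\<in>A. a < x"
proof (rule ccontr)
  assume "\<not> ?thesis"
  then have "A \<subseteq> {..a}" by (auto simp: not_less)
  then show False using assms countable_atMost_omega1 countable_subset by blast
qed

text \<open>\<omega>1 has uncountable cofinality: otherwise the countable segments
  \<open>{..x}\<close>, for countably many \<open>x\<close>, would cover it.\<close>

lemma countable_imp_bounded_omega1:
  assumes "countable (A :: omega1 set)"
  shows "\<exists>a. \<forall>x\<in>A. x \<le> a"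
proof (rule ccontr)
  assume "\<not> ?thesis"
  then have "\<exists>x\<in>A. y \<le> x" for y by (meson linear)
  then have "UNIV = (\<Union>x\<in>A. {..x})" by auto
  moreover have "countable (\<Union>x\<in>A. {..x})"
    using assms by (intro countable_UN countable_atMost_omega1)
  ultimately show False using uncountable_omega1 by simp
qed

lemma ex_greater_omega1: "\<exists>x. (a :: omega1) < x"
  using uncountable_imp_unbounded_omega1[OF uncountable_omega1] by blast

section \<open>Clubs and stationary sets\<close>

lemma stationary_uncountable:
  assumes "stationary S" shows "uncountable S"
proof
  assume "countable S"
  then obtain a where a: "\<forall>x\<in>S. x \<le> a" using countable_imp_bounded_omega1 by blast
  obtain b where "a < b" using ex_greater_omega1 by blast
  \<comment> \<open>A tail starting beyond the bound \<open>a\<close> of \<open>S\<close> is a club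
    that \<open>S\<close> would miss.\<close>
  have "\<exists>c\<in>{b..}. d < c" for d
    using ex_greater_omega1[of "max b d"] by (force intro: less_imp_le)
  then have "club {b..}" by (auto simp: club_def)
  then obtain s where "s \<in> S" "b \<le> s" using assms by (auto simp: stationary_def)
  then show False using a \<open>a < b\<close> by force
qed

text \<open>Choose points of \<open>A\<close> and \<open>B\<close> alternately, each above the
  previous one; both sequences converge to their common supremum, which therefore lies in both
  closures and can be pushed above any \<open>a\<close>.\<close>

lemma club_closure_Int:
  fixes A B :: "omega1 set"
  assumes A: "\<And>a. \<exists>x\<in>A. a < x" and B: "\<And>a. \<exists>x\<in>B. a < x"
  shows "club (closure A \<inter> closure B)"
  unfolding club_def
proof (intro conjI allI)
  show "closed (closure A \<inter> closure B)" by blast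
  fix a
  obtain f where f: "\<And>a. f a \<in> A" "\<And>a. a < f a" using A by metis
  obtain g where g: "\<And>a. g a \<in> B" "\<And>a. a < g a" using B by metis
  define x where "x n = ((\<lambda>y. f (g y)) ^^ n) (f a)" for n
  have x_Suc: "x (Suc n) = f (g (x n))" for n by (simp add: x_def)
  have x_A: "x n \<in> A" for n by (cases n) (auto simp: x_def f)
  have x_g: "x n < g (x n)" "g (x n) < x (Suc n)" for n using f g by (auto simp: x_Suc)
  then have "strict_mono x" by (meson less_trans strict_mono_Suc_iff)
  \<comment> \<open>The supremum of \<open>x\<close>, which exists because countable sets are
    bounded. By minimality every \<open>d < c\<close> is exceeded by some
    \<open>x m\<close>.\<close>
  define c where "c = (LEAST u. \<forall>n. x n \<le> u)"
  have "\<exists>u. \<forall>n. x n \<le> u"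
    using countable_imp_bounded_omega1[of "range x"] by auto
  then have c: "x n \<le> c" for n unfolding c_def by (rule LeastI2_ex) auto
  have x_less: "x n < c" for n
    using c[of "Suc n"] x_g by (meson less_le_trans less_trans)
  have below: "\<forall>\<^sub>F n in sequentially. d < x n" if "d < c" for d
  proof -
    have "\<not> (\<forall>n. x n \<le> d)" using that not_less_Least unfolding c_def by blast
    then obtain m where "d < x m" by (auto simp: not_le)
    then show ?thesis
      using \<open>strict_mono x\<close> unfolding eventually_sequentially
      by (meson less_le_trans strict_mono_less_eq)
  qed
  have "x \<longlonglongrightarrow> c"
    by (rule order_tendstoI) (use below x_less in \<open>auto intro!: always_eventually intro: less_trans\<close>)
  then have "c \<in> closure A"
    by (rule Lim_in_closed_set[OF closed_closure, rotated 2])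
      (use x_A closure_subset in \<open>auto intro!: always_eventually\<close>)
  moreover have "(\<lambda>n. g (x n)) \<longlonglongrightarrow> c"
  proof (rule order_tendstoI)
    show "\<forall>\<^sub>F n in sequentially. d < g (x n)" if "d < c" for d
      using below[OF that] by eventually_elim (use x_g in \<open>auto intro: less_trans\<close>)
    show "\<forall>\<^sub>F n in sequentially. g (x n) < d" if "c < d" for d
      using that x_g(2) x_less by (meson always_eventually less_trans)
  qed
  then have "c \<in> closure B"
    by (rule Lim_in_closed_set[OF closed_closure, rotated 2])
      (use g closure_subset in \<open>auto intro!: always_eventually\<close>)
  moreover have "a < c" using x_less[of 0] f(2)[of a] by (auto simp: x_def)
  ultimately show "\<exists>c\<in>closure A \<inter> closure B. a < c" by blast
qed

text \<open>\<open>S\<close> meets the club \<open>closure P \<inter> closure Q\<close>, and a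
  relatively closed set contains all its closure points that lie in \<open>S\<close>.\<close>

lemma stationary_closedin_Int_nonempty:
  assumes "stationary S"
    and P: "closedin (top_of_set S) P" "\<And>a. \<exists>x\<in>P. a < x"
    and Q: "closedin (top_of_set S) Q" "\<And>a. \<exists>x\<in>Q. a < x"
  shows "P \<inter> Q \<noteq> {}"
proof -
  obtain s where s: "s \<in> S" "s \<in> closure P" "s \<in> closure Q"
    using assms(1) club_closure_Int[OF P(2) Q(2)] by (auto simp: stationary_def)
  have mem: "s \<in> R" if R: "closedin (top_of_set S) R" "s \<in> closure R" for R
  proof -
    obtain T where T: "closed T" "R = S \<inter> T" using R(1) by (auto simp: closedin_closed)
    then have "closure R \<subseteq> T" by (simp add: closure_minimal)
    then show ?thesis using T R(2) s(1) by blast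
  qed
  then show ?thesis using P(1) Q(1) s by blast
qed

section \<open>Condensation points of maps into \<open>X\<close>\<close>

lemma stationary_condensation_imp_eventually_const:
  assumes S: "stationary S" and X: "regular_space X" and x: "gdelta_in X {x}"
    and f: "continuous_map (top_of_set S) X f"
    and dense: "\<And>U. openin X U \<Longrightarrow> x \<in> U \<Longrightarrow> uncountable {s\<in>S. f s \<in> U}"
  shows "\<exists>a. \<forall>s\<in>S. a < s \<longrightarrow> f s = x"
proof -
  have tail: "\<exists>a. \<forall>s\<in>S. a < s \<longrightarrow> f s \<in> U" if U: "openin X U" "x \<in> U" for U
  proof (rule ccontr)
    assume no: "\<not> ?thesis"
    obtain W V where WV: "openin X W" "closedin X V" "x \<in> W" "W \<subseteq> V" "V \<subseteq> U"
      using X U unfolding neighbourhood_base_of_closedin[symmetric] neighbourhood_base_of by meson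
    \<comment> \<open>\<open>P\<close> is unbounded because it contains the uncountable preimage of
      \<open>W\<close>, and \<open>Q\<close> because no tail is mapped into \<open>U\<close>; yet
      \<open>V \<subseteq> U\<close> makes them disjoint.\<close>
    define P where "P = {s\<in>S. f s \<in> V}"
    define Q where "Q = {s\<in>S. f s \<in> topspace X - U}"
    have "closedin (top_of_set S) P" "closedin (top_of_set S) Q"
      using closedin_continuous_map_preimage[OF f WV(2)]
        closedin_continuous_map_preimage[OF f openin_closedin_eq[THEN iffD1, OF U(1), THEN conjunct2]]
      by (simp_all add: P_def Q_def)
    moreover have "\<exists>s\<in>P. a < s" for a
      using uncountable_imp_unbounded_omega1[OF dense[OF WV(1,3)], of a] WV(4) by (auto simp: P_def)
    moreover have "\<exists>s\<in>Q. a < s" for a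
      using no continuous_map_image_subset_topspace[OF f] by (auto simp: Q_def)
    ultimately have "P \<inter> Q \<noteq> {}" using stationary_closedin_Int_nonempty[OF S] by blast
    then show False using WV(5) by (auto simp: P_def Q_def)
  qed
  obtain \<U> where \<U>: "countable \<U>" "\<And>U. U \<in> \<U> \<Longrightarrow> openin X U" "\<Inter>\<U> = {x}"
    using x unfolding gdelta_in_alt intersection_of_def by auto
  have "\<forall>U\<in>\<U>. \<exists>a. \<forall>s\<in>S. a < s \<longrightarrow> f s \<in> U" using tail \<U> by blast
  then obtain b where b: "\<And>U s. U \<in> \<U> \<Longrightarrow> s \<in> S \<Longrightarrow> b U < s \<Longrightarrow> f s \<in> U" by metis
  \<comment> \<open>Beyond a common bound of the countably many \<open>b U\<close>, \<open>f\<close>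
    takes its values in \<open>\<Inter>\<U>\<close>.\<close>
  obtain a where "\<forall>d\<in>b ` \<U>. d \<le> a"
    using countable_imp_bounded_omega1[of "b ` \<U>"] \<U>(1) by blast
  then have "\<forall>s\<in>S. a < s \<longrightarrow> f s \<in> \<Inter>\<U>" using b by (auto intro: le_less_trans)
  then show ?thesis unfolding \<U>(3) by blast
qed

text \<open>Without such a point, the complements of the closures of the tails of \<open>f\<close>
  on \<open>E\<close> form an increasing open cover indexed by \<omega>1, which has no countable
  subcover. Uncountability is measured on arguments, not values, so that \<open>f\<close> may be far
  from injective.\<close>

lemma aleph0_aleph1_compact_condensation:
  fixes f :: "omega1 \<Rightarrow> 'a" and E :: "omega1 set"
  assumes N: "aleph0_aleph1_compact_space (subtopology X N)"
    and E: "uncountable E" and f: "f ` E \<subseteq> topspace X \<inter> N"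
  shows "\<exists>x \<in> topspace X \<inter> N. \<forall>U. openin X U \<and> x \<in> U \<longrightarrow> uncountable {s\<in>E. f s \<in> U}"
proof (rule ccontr)
  let ?Y = "subtopology X N"
  assume no: "\<not> ?thesis"
  define W where "W a = topspace ?Y - ?Y closure_of (f ` (E \<inter> {a<..}))" for a
  have op: "openin ?Y (W a)" for a by (simp only: W_def openin_diff openin_topspace closedin_closure_of)
  have mono: "W a \<subseteq> W b" if "a \<le> b" for a b
    unfolding W_def using that by (intro Diff_mono order_refl closure_of_mono image_mono) auto
  have cover: "\<Union>(range W) = topspace ?Y"
  proof
    show "\<Union>(range W) \<subseteq> topspace ?Y" by (auto simp: W_def)
    show "topspace ?Y \<subseteq> \<Union>(range W)"
    proof
      fix x assume x: "x \<in> topspace ?Y"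
      then obtain U where U: "openin X U" "x \<in> U" "countable {s\<in>E. f s \<in> U}" using no by auto
      \<comment> \<open>Beyond \<open>a\<close> no value of \<open>f\<close> on \<open>E\<close>
        lies in \<open>U\<close>, which puts \<open>x\<close> into \<open>W a\<close>.\<close>
      obtain a where a: "\<forall>s\<in>{s\<in>E. f s \<in> U}. s \<le> a"
        using countable_imp_bounded_omega1[OF U(3)] by blast
      have "x \<notin> ?Y closure_of (f ` (E \<inter> {a<..}))"
      proof
        assume "x \<in> ?Y closure_of (f ` (E \<inter> {a<..}))"
        moreover have "openin ?Y (U \<inter> N)" using U(1) by (simp add: openin_subtopology_Int)
        ultimately have "\<exists>y\<in>f ` (E \<inter> {a<..}). y \<in> U \<inter> N"
          using x U(2) unfolding in_closure_of by auto
        then show False using a by force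
      qed
      then show "x \<in> \<Union>(range W)" using x by (auto simp: W_def)
    qed
  qed
  have "range W \<lesssim> (UNIV :: omega1 set)" by (rule image_lepoll)
  with N op cover obtain \<V> where \<V>: "\<V> \<subseteq> range W" "countable \<V>" "\<Union>\<V> = topspace ?Y"
    unfolding aleph0_aleph1_compact_space_def by (metis (no_types, lifting) imageE)
  obtain A where A: "countable A" "\<V> = W ` A"
    using \<V>(1,2) by (metis countable_subset_image)
  obtain b where "\<forall>a\<in>A. a \<le> b" using countable_imp_bounded_omega1[OF A(1)] by blast
  \<comment> \<open>As \<open>W\<close> is increasing, the countable subcover collapses to the
    single set \<open>W b\<close>.\<close>
  then have Wb: "topspace ?Y \<subseteq> W b" using mono \<V>(3) A(2) by blast
  obtain s where s: "s \<in> E" "b < s" using uncountable_imp_unbounded_omega1[OF E] by blast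
  then have "f s \<in> topspace ?Y" using f by auto
  moreover have "f s \<in> ?Y closure_of (f ` (E \<inter> {b<..}))"
    using s closure_of_subset[of "f ` (E \<inter> {b<..})" ?Y] f by auto
  ultimately show False using Wb by (auto simp: W_def)
qed

section \<open>Homotopies on a stationary set\<close>

lemma continuous_map_slices:
  assumes "continuous_map (prod_topology Y Z) X h"
  shows "z \<in> topspace Z \<Longrightarrow> continuous_map Y X (\<lambda>y. h (y, z))"
    and "y \<in> topspace Y \<Longrightarrow> continuous_map Z X (\<lambda>z. h (y, z))"
  by (auto intro!: continuous_map_compose[OF _ assms, unfolded o_def]
      simp: continuous_map_pairedI)

lemma stationary_homotopy_eventually_const:
  fixes X :: "'a topology" and S :: "omega1 set" and h :: "omega1 \<times> real \<Rightarrow> 'a"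
  assumes X: "regular_space X" "Hausdorff_space X"
    and gdelta: "\<And>x. x \<in> topspace X \<Longrightarrow> gdelta_in X {x}"
    and nbhd: "\<And>x. x \<in> topspace X \<Longrightarrow>
      \<exists>N. closedin X N \<and> x \<in> X interior_of N \<and> aleph0_aleph1_compact_space (subtopology X N)"
    and S: "stationary S"
    and h: "continuous_map (prod_topology (top_of_set S) (top_of_set {0..1})) X h"
    and const: "(\<lambda>s. h (s, 0)) constant_on S"
  shows "\<exists>a x. \<forall>s\<in>S. a < s \<longrightarrow> h (s, 1) = x"
proof -
  have h1: "continuous_map (top_of_set S) X (\<lambda>s. h (s, t))" if "t \<in> {0..1}" for t
    using continuous_map_slices(1)[OF h] that by simp
  have h2: "continuous_map (top_of_set {0..1}) X (\<lambda>t. h (s, t))" if "s \<in> S" for s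
    using continuous_map_slices(2)[OF h] that by simp
  have h_in: "h (s, t) \<in> topspace X" if "s \<in> S" "t \<in> {0..1}" for s t
    using continuous_map_image_subset_topspace[OF h] that by auto
  \<comment> \<open>Both the tail and the value may vary with \<open>t\<close>. Connectedness of the
    unit interval carries membership in \<open>T\<close> from \<open>0\<close> to
    \<open>1\<close>.\<close>
  define T where "T = {t\<in>{0..1}. \<exists>a x. \<forall>s\<in>S. a < s \<longrightarrow> h (s, t) = x}"
  have "0 \<in> T" using const by (auto simp: T_def constant_on_def)
  moreover have "closedin (top_of_set {0..1}) T"
  proof -
    have "l \<in> T" if t: "\<And>n. t n \<in> T" "t \<longlonglongrightarrow> l" for t l
    proof -
      have l: "l \<in> {0..1}" and t01: "\<And>n. t n \<in> {0..1}"
        using closed_sequentially[OF closed_atLeastAtMost _ t(2)] t(1) by (auto simp: T_def)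
      have "\<forall>n. \<exists>a x. \<forall>s\<in>S. a < s \<longrightarrow> h (s, t n) = x" using t(1) by (auto simp: T_def)
      then obtain a x where ax: "\<And>n s. s \<in> S \<Longrightarrow> a n < s \<Longrightarrow> h (s, t n) = x n" by metis
      obtain b where b: "\<And>n. a n \<le> b" using countable_imp_bounded_omega1[of "range a"] by auto
      \<comment> \<open>For every \<open>s\<close> beyond \<open>b\<close>, the sequence
        \<open>h (s, t n)\<close> is the same sequence \<open>x\<close>; uniqueness of limits then
        makes \<open>h (s, l)\<close> independent of \<open>s\<close>.\<close>
      have lim: "limitin X x (h (s, l)) sequentially" if s: "s \<in> S" "b < s" for s
      proof -
        have "limitin (top_of_set {0..1}) t l sequentially"
          using l t01 t(2) by (simp add: limitin_subtopology)
        from continuous_map_limit[OF h2[OF s(1)] this]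
        have "limitin X (\<lambda>n. h (s, t n)) (h (s, l)) sequentially" by (simp add: o_def)
        moreover have "(\<lambda>n. h (s, t n)) = x" using ax[OF s(1)] b s(2) le_less_trans by (intro ext) blast
        ultimately show ?thesis by simp
      qed
      obtain s0 where s0: "s0 \<in> S" "b < s0"
        using uncountable_imp_unbounded_omega1[OF stationary_uncountable[OF S]] by blast
      have "h (s, l) = h (s0, l)" if "s \<in> S" "b < s" for s
        using limitin_Hausdorff_unique[OF lim[OF that] lim[OF s0]] X(2) by simp
      then show ?thesis using l by (auto simp: T_def)
    qed
    then have "closed T" unfolding closed_sequential_limits by blast
    then show ?thesis by (intro closed_subset) (auto simp: T_def)
  qed
  moreover have "openin (top_of_set {0..1}) T"
    unfolding openin_euclidean_subtopology_iff
  proof (intro conjI ballI)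
    show "T \<subseteq> {0..1}" by (auto simp: T_def)
    fix t assume t: "t \<in> T"
    then obtain a x where ax: "\<And>s. s \<in> S \<Longrightarrow> a < s \<Longrightarrow> h (s, t) = x" and t01: "t \<in> {0..1}"
      unfolding T_def by blast
    obtain s0 where s0: "s0 \<in> S" "a < s0"
      using uncountable_imp_unbounded_omega1[OF stationary_uncountable[OF S]] by blast
    then have "x \<in> topspace X" using ax h_in t01 by metis
    then obtain N where N: "x \<in> X interior_of N" "aleph0_aleph1_compact_space (subtopology X N)"
      using nbhd by blast
    \<comment> \<open>Continuity in time gives each \<open>s\<close> its own radius around
      \<open>t\<close>. Sorting by radii \<open>1 / Suc n\<close> gives countably many classes, so
      one radius serves uncountably many \<open>s\<close>.\<close>
    define E where "E n = {s\<in>S \<inter> {a<..}. \<forall>t'\<in>{0..1}. dist t' t < 1 / Suc n \<longrightarrow> h (s, t') \<in> N}"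
      for n :: nat
    have "S \<inter> {a<..} \<subseteq> (\<Union>n. E n)"
    proof
      fix s assume s: "s \<in> S \<inter> {a<..}"
      have "openin (top_of_set {0..1}) {t\<in>{0..1}. h (s, t) \<in> X interior_of N}"
        using openin_continuous_map_preimage[OF h2, of s "X interior_of N"] s by simp
      moreover have "h (s, t) \<in> X interior_of N" using ax s N by auto
      ultimately obtain e where e: "e > 0"
        "\<And>t'. t' \<in> {0..1} \<Longrightarrow> dist t' t < e \<Longrightarrow> h (s, t') \<in> X interior_of N"
        using t01 unfolding openin_euclidean_subtopology_iff by blast
      obtain n where "1 / Suc n < e" using e(1) nat_approx_posE by blast
      then have "s \<in> E n"
        using s e(2) interior_of_subset[of X N] by (fastforce simp: E_def)
      then show "s \<in> (\<Union>n. E n)" by blast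
    qed
    moreover have "uncountable (S \<inter> {a<..})"
    proof
      assume "countable (S \<inter> {a<..})"
      then have "countable ((S \<inter> {a<..}) \<union> {..a})" using countable_atMost_omega1 by simp
      moreover have "S \<subseteq> (S \<inter> {a<..}) \<union> {..a}" by auto
      ultimately show False using stationary_uncountable[OF S] countable_subset by blast
    qed
    ultimately have "uncountable (\<Union>n. E n)" using countable_subset by blast
    then obtain n where n: "uncountable (E n)"
      using countable_UN[OF countableI_type, of UNIV E] by blast
    have "t' \<in> T" if t': "t' \<in> {0..1}" "dist t' t < 1 / Suc n" for t'
    proof -
      have "(\<lambda>s. h (s, t')) ` E n \<subseteq> topspace X \<inter> N" using t' h_in by (auto simp: E_def)
      \<comment> \<open>The eventual value \<open>y\<close> at time \<open>t'\<close> may differ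
        from the value \<open>x\<close> at time \<open>t\<close>.\<close>
      from aleph0_aleph1_compact_condensation[OF N(2) n this] obtain y where
        y: "y \<in> topspace X" "\<And>U. openin X U \<Longrightarrow> y \<in> U \<Longrightarrow> uncountable {s\<in>E n. h (s, t') \<in> U}"
        by blast
      have "uncountable {s\<in>S. h (s, t') \<in> U}" if "openin X U" "y \<in> U" for U
      proof -
        have "{s\<in>E n. h (s, t') \<in> U} \<subseteq> {s\<in>S. h (s, t') \<in> U}" by (auto simp: E_def)
        then show ?thesis using y(2)[OF that] countable_subset by blast
      qed
      from stationary_condensation_imp_eventually_const[OF S X(1) gdelta[OF y(1)] h1[OF t'(1)] this]
      show ?thesis using t'(1) by (auto simp: T_def)
    qed
    then show "\<exists>e>0. \<forall>t'\<in>{0..1}. dist t' t < e \<longrightarrow> t' \<in> T"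
      by (intro exI[of _ "1 / Suc n"]) auto
  qed
  ultimately have "T = {0..1}"
    using connected_clopen[of "{0..1::real}"] connected_Icc by blast
  then have "1 \<in> T" by simp
  then show ?thesis by (simp add: T_def)
qed

section \<open>Uncountable images and contractibility\<close>

theorem theorem1p5:
  fixes X :: "'a topology" and S :: "omega1 set"
  assumes "regular_space X" and "Hausdorff_space X"
    and "\<And>x. x \<in> topspace X \<Longrightarrow> gdelta_in X {x}"
    and "\<And>x. x \<in> topspace X \<Longrightarrow>
      \<exists>N. closedin X N \<and> x \<in> X interior_of N \<and> aleph0_aleph1_compact_space (subtopology X N)"
    and "stationary S"
  shows "(\<nexists>h :: omega1 \<times> real \<Rightarrow> 'a.
            continuous_map (prod_topology (top_of_set S) (top_of_set {0..1})) X h \<and>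
            uncountable ((\<lambda>s. h (s, 1)) ` S) \<and> (\<lambda>s. h (s, 0)) constant_on S) \<and>
         ((\<exists>Y \<subseteq> topspace X. subtopology X Y homeomorphic_space top_of_set S) \<longrightarrow>
            \<not> contractible_space X)"
proof -
  have no_homotopy: False
    if h: "continuous_map (prod_topology (top_of_set S) (top_of_set {0..1})) X h"
      and img: "uncountable ((\<lambda>s. h (s, 1)) ` S)" and const: "(\<lambda>s. h (s, 0)) constant_on S"
    for h :: "omega1 \<times> real \<Rightarrow> 'a"
  proof -
    obtain a x where "\<forall>s\<in>S. a < s \<longrightarrow> h (s, 1) = x"
      using stationary_homotopy_eventually_const[OF assms h const] by blast
    then have "(\<lambda>s. h (s, 1)) ` S \<subseteq> insert x ((\<lambda>s. h (s, 1)) ` {..a})"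
      by (auto simp: not_less[symmetric])
    then show False
      using img countable_atMost_omega1 by (meson countable_image countable_insert countable_subset)
  qed
  moreover have "\<not> contractible_space X"
    if Y: "Y \<subseteq> topspace X" "subtopology X Y homeomorphic_space top_of_set S" for Y
  proof
    assume "contractible_space X"
    then obtain c k where k: "continuous_map (prod_topology (top_of_set {0..1::real}) X) X k"
      "\<And>x. k (0, x) = x" "\<And>x. k (1, x) = c"
      by (auto simp: contractible_space_def homotopic_with_def)
    obtain g where g: "homeomorphic_map (top_of_set S) (subtopology X Y) g"
      using Y(2) homeomorphic_space homeomorphic_space_sym by blast
    then have "continuous_map (top_of_set S) X g" and inj: "inj_on g S"
      by (auto simp: homeomorphic_imp_injective_map continuous_map_in_subtopology
          dest: homeomorphic_imp_continuous_map homeomorphic_imp_injective_map)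
    \<comment> \<open>The contraction \<open>k\<close> runs from the identity to a constant, so time
      is reversed. At time \<open>1\<close> the map is the injective \<open>g\<close>, whose image
      of \<open>S\<close> is uncountable.\<close>
    define h where "h = (\<lambda>p. k (1 - snd p, g (fst p)))"
    have "continuous_map (prod_topology (top_of_set S) (top_of_set {0..1})) X h"
    proof -
      have "continuous_map (top_of_set {0..1}) (top_of_set {0..1}) (\<lambda>t::real. 1 - t)"
        by (auto intro!: continuous_intros)
      from continuous_map_compose[OF continuous_map_snd this]
        continuous_map_compose[OF continuous_map_fst \<open>continuous_map (top_of_set S) X g\<close>]
      show ?thesis
        unfolding h_def o_def
        by (intro continuous_map_compose[OF _ k(1), unfolded o_def] continuous_map_pairedI)
    qed
    moreover have "uncountable ((\<lambda>s. h (s, 1)) ` S)"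
      using countable_image_inj_on[OF _ inj] stationary_uncountable[OF assms(5)]
      by (auto simp: h_def k)
    moreover have "(\<lambda>s. h (s, 0)) constant_on S" by (auto simp: h_def k constant_on_def)
    ultimately show False by (rule no_homotopy)
  qed
  ultimately show ?thesis by blast
qed

end
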